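(* Let $a<b$ be real numbers, $\alpha\in(0,1)$, and let $p,q,r$ be real-valued continuous functions on $[a,b]$ with $p(t)>0$ and $r(t)>0$ for all $t\in[a,b]$. Consider the fractional Sturm--Liouville equation $${}^{ABR}_{a}D^\alpha\big(p(t)\,{}^{ABR}D^\alpha_b x(t)\big)+q(t)x(t)=\lambda r(t)x(t),\qquad t\in(a,b).$$ Eigenfunctions corresponding to distinct eigenvalues of this equation are orthogonal with respect to the weight function $r$ on $[a,b]$: if $\lambda_1\neq\lambda_2$ are eigenvalues with corresponding eigenfunctions $x_{\lambda_1},x_{\lambda_2}$, then $$\int_a^b r(t)\,x_{\lambda_1}(t)\,x_{\lambda_2}(t)\,dt=0.$$
   Context: For $\alpha\in(0,1)$, $E_\alpha(z)=\sum_{k=0}^\infty \frac{z^k}{\Gamma(\alpha k+1)}$ is the Mittag-Leffler function, and $B(\alpha)>0$ is a normalization constant. For a (complex-valued) $f\in H^1(a,b)$, identified with its continuous representative on $[a,b]$, the left and right ABR (Riemann--Liouville type) fractional derivatives with Mittag-Leffler kernel are $${}^{ABR}_{a}D^\alpha f(t)=\frac{B(\alpha)}{1-\alpha}\frac{d}{dt}\int_a^t f(x)E_\alpha\Big(\tfrac{-\alpha}{1-\alpha}(t-x)^\alpha\Big)dx,\qquad {}^{ABR}D^\alpha_b f(t)=-\frac{B(\alpha)}{1-\alpha}\frac{d}{dt}\int_t^b f(x)E_\alpha\Big(\tfrac{-\alpha}{1-\alpha}(x-t)^\alpha\Big)dx,$$ with one-sided derivatives at the endpoints of $[a,b]$.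 A solution of the equation is a complex-valued $x\in H^1(a,b)$ with $p\cdot{}^{ABR}D_b^\alpha x\in H^1(a,b)$ satisfying the equation. An eigenvalue is a $\lambda\in\mathbb{C}$ for which there is a nontrivial solution (one not identically zero), called an eigenfunction corresponding to $\lambda$. *)

theory Defs
  imports "HOL-Analysis.Analysis"
begin

definition mittag_leffler :: "real \<Rightarrow> complex \<Rightarrow> complex" where
  "mittag_leffler \<alpha> z = (\<Sum>k. z ^ k / complex_of_real (Gamma (\<alpha> * real k + 1)))"

(* On (a,b): Lebesgue measurable with integrable square. *)
definition L2_on :: "real \<Rightarrow> real \<Rightarrow> (real \<Rightarrow> complex) \<Rightarrow> bool" where
  "L2_on a b f \<longleftrightarrow>
     f \<in> borel_measurable (lebesgue_on {a<..<b}) \<and>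
     integrable (lebesgue_on {a<..<b}) (\<lambda>t. (norm (f t))\<^sup>2)"

(* Real-valued elements of C_c^infinity(a,b), extended by zero to the real line; by linearity
   they determine the same weak derivatives as complex-valued test functions. *)
definition test_function :: "real \<Rightarrow> real \<Rightarrow> (real \<Rightarrow> real) \<Rightarrow> bool" where
  "test_function a b \<phi> \<longleftrightarrow>
     (\<forall>n t. (deriv ^^ n) \<phi> field_differentiable at t) \<and>
     (\<exists>K. compact K \<and> K \<subseteq> {a<..<b} \<and> (\<forall>t. t \<notin> K \<longrightarrow> \<phi> t = 0))"

definition weak_derivative_on ::
    "real \<Rightarrow> real \<Rightarrow> (real \<Rightarrow> complex) \<Rightarrow> (real \<Rightarrow> complex) \<Rightarrow> bool" where
  "weak_derivative_on a b f g \<longleftrightarrow>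
     (\<forall>\<phi>. test_function a b \<phi> \<longrightarrow>
        (LINT t|lebesgue_on {a<..<b}. f t * complex_of_real (deriv \<phi> t)) =
        - (LINT t|lebesgue_on {a<..<b}. g t * complex_of_real (\<phi> t)))"

(* H^1(a,b), an element being given by its continuous representative on the closed interval. *)
definition H1_on :: "real \<Rightarrow> real \<Rightarrow> (real \<Rightarrow> complex) \<Rightarrow> bool" where
  "H1_on a b f \<longleftrightarrow>
     continuous_on {a..b} f \<and> L2_on a b f \<and> (\<exists>g. L2_on a b g \<and> weak_derivative_on a b f g)"

(* Derivatives are taken within the closed interval, hence one-sided at a and b. They exist
   at every point when f satisfies H1_on a b; only such f are of interest, since
   vector_derivative is unspecified at points of non-differentiability. *)
definition ABR_left ::
    "(real \<Rightarrow> real) \<Rightarrow> real \<Rightarrow> real \<Rightarrow> real \<Rightarrow> (real \<Rightarrow> complex) \<Rightarrow> real \<Rightarrow> complex" where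
  "ABR_left B \<alpha> a b f t =
     complex_of_real (B \<alpha> / (1 - \<alpha>)) *
     vector_derivative
       (\<lambda>s. integral {a..s}
          (\<lambda>x. f x * mittag_leffler \<alpha> (complex_of_real (- \<alpha> / (1 - \<alpha>) * (s - x) powr \<alpha>))))
       (at t within {a..b})"

definition ABR_right ::
    "(real \<Rightarrow> real) \<Rightarrow> real \<Rightarrow> real \<Rightarrow> real \<Rightarrow> (real \<Rightarrow> complex) \<Rightarrow> real \<Rightarrow> complex" where
  "ABR_right B \<alpha> a b f t =
     - complex_of_real (B \<alpha> / (1 - \<alpha>)) *
     vector_derivative
       (\<lambda>s. integral {s..b}
          (\<lambda>x. f x * mittag_leffler \<alpha> (complex_of_real (- \<alpha> / (1 - \<alpha>) * (x - s) powr \<alpha>))))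
       (at t within {a..b})"

definition FSL_solution ::
    "(real \<Rightarrow> real) \<Rightarrow> real \<Rightarrow> real \<Rightarrow> real \<Rightarrow> (real \<Rightarrow> real) \<Rightarrow> (real \<Rightarrow> real) \<Rightarrow> (real \<Rightarrow> real) \<Rightarrow>
     complex \<Rightarrow> (real \<Rightarrow> complex) \<Rightarrow> bool" where
  "FSL_solution B \<alpha> a b p q r \<mu> x \<longleftrightarrow>
     H1_on a b x \<and>
     H1_on a b (\<lambda>t. complex_of_real (p t) * ABR_right B \<alpha> a b x t) \<and>
     (\<forall>t\<in>{a<..<b}.
        ABR_left B \<alpha> a b (\<lambda>s. complex_of_real (p s) * ABR_right B \<alpha> a b x s) t
          + complex_of_real (q t) * x t
        = \<mu> * complex_of_real (r t) * x t)"

definition FSL_eigenfunction ::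
    "(real \<Rightarrow> real) \<Rightarrow> real \<Rightarrow> real \<Rightarrow> real \<Rightarrow> (real \<Rightarrow> real) \<Rightarrow> (real \<Rightarrow> real) \<Rightarrow> (real \<Rightarrow> real) \<Rightarrow>
     complex \<Rightarrow> (real \<Rightarrow> complex) \<Rightarrow> bool" where
  "FSL_eigenfunction B \<alpha> a b p q r \<mu> x \<longleftrightarrow>
     FSL_solution B \<alpha> a b p q r \<mu> x \<and> (\<exists>t\<in>{a..b}. x t \<noteq> 0)"

definition FSL_eigenvalue ::
    "(real \<Rightarrow> real) \<Rightarrow> real \<Rightarrow> real \<Rightarrow> real \<Rightarrow> (real \<Rightarrow> real) \<Rightarrow> (real \<Rightarrow> real) \<Rightarrow> (real \<Rightarrow> real) \<Rightarrow>
     complex \<Rightarrow> bool" where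
  "FSL_eigenvalue B \<alpha> a b p q r \<mu> \<longleftrightarrow> (\<exists>x. FSL_eigenfunction B \<alpha> a b p q r \<mu> x)"

end

theory Submission
  imports Defs
begin

text \<open>The kernel \<open>K u = E\<^sub>\<alpha> (- \<alpha> / (1 - \<alpha>) * u powr \<alpha>)\<close> satisfies \<open>K u = 1 + (\<integral>t=0..u. k t)\<close> with \<open>k\<close>
  integrable, being bounded by a multiple of \<open>u powr (\<alpha> - 1)\<close>. Hence for a merely continuous \<open>f\<close>
  the two fractional derivatives are \<open>B \<alpha> / (1 - \<alpha>)\<close> times \<open>f + f * k\<close> and \<open>f + f * k'\<close>, where \<open>*\<close> is
  convolution and \<open>k' u = k (- u)\<close>. By Fubini they are adjoint to each other for the bilinear
  form \<open>\<integral> f g\<close>, so the Sturm-Liouville operator is symmetric and eigenfunctions for distinct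
  eigenvalues are orthogonal.\<close>

subsection \<open>The Mittag-Leffler kernel\<close>

text \<open>Restrict Euler's integral for \<open>Gamma x\<close> to \<open>{A..A+1}\<close>: there
  the integrand is at least \<open>A powr (x - 1) / exp (A + 1)\<close>, since x \<ge> 1. The factor
  \<open>exp (A + 1)\<close> does not depend on \<open>x\<close>, so Gamma outgrows every geometric
  sequence.\<close>

lemma powr_le_exp_mult_Gamma:
  fixes A x :: real
  assumes "A > 0" "x \<ge> 1"
  shows "A powr (x - 1) \<le> exp (A + 1) * Gamma x"
proof -
  let ?c = "A powr (x - 1) / exp (A + 1)"
  have c: "((\<lambda>t. ?c) has_integral ?c) {A..A+1}"
    using has_integral_const_real[of ?c A "A+1"] by simp
  have I: "((\<lambda>t. t powr (x - 1) / exp t) has_integral integral {A..A+1} (\<lambda>t. t powr (x - 1) / exp t)) {A..A+1}"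
    using assms by (intro integrable_integral integrable_continuous_real continuous_intros) auto
  have "?c \<le> integral {A..A+1} (\<lambda>t. t powr (x - 1) / exp t)"
    by (rule has_integral_le[OF c I]) (use assms in \<open>auto intro!: frac_le powr_mono2\<close>)
  also have "\<dots> \<le> Gamma x"
    by (rule has_integral_subset_le[OF _ I Gamma_integral_real]) (use assms in auto)
  finally show ?thesis by (simp add: field_simps)
qed

definition ml_coeff :: "real \<Rightarrow> nat \<Rightarrow> complex" where
  "ml_coeff \<alpha> n = 1 / complex_of_real (Gamma (\<alpha> * real n + 1))"

lemma summable_ml_coeff:
  assumes "\<alpha> > 0"
  shows "summable (\<lambda>n. ml_coeff \<alpha> n * z ^ n)"
proof -
  \<comment> \<open>\<open>A\<close> is chosen so that \<open>A powr (\<alpha> * real n)\<close> is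
    exactly \<open>(2 * R) ^ n\<close>; the factor 2 leaves a geometric majorant of ratio 1/2.
    Adding 1 keeps \<open>R\<close> positive at z = 0.\<close>
  define R where "R = norm z + 1"
  define A where "A = (2 * R) powr (1 / \<alpha>)"
  have R: "R > 0" "norm z \<le> R" by (auto simp: R_def add_nonneg_pos)
  have A: "A > 0" using R by (simp add: A_def)
  have "norm (ml_coeff \<alpha> n * z ^ n) \<le> exp (A + 1) * (1/2) ^ n" for n
  proof -
    have pos: "Gamma (\<alpha> * real n + 1) > 0" using assms by (intro Gamma_real_pos) (auto intro: add_nonneg_pos)
    have "A powr (\<alpha> * real n) = (2 * R) ^ n"
      using assms R by (simp add: A_def powr_powr powr_realpow)
    hence "(2 * R) ^ n \<le> exp (A + 1) * Gamma (\<alpha> * real n + 1)"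
      using powr_le_exp_mult_Gamma[OF A, of "\<alpha> * real n + 1"] assms by simp
    moreover have "norm z ^ n \<le> R ^ n" using R by (intro power_mono) auto
    hence "2 ^ n * norm z ^ n \<le> (2 * R) ^ n" by (simp add: power_mult_distrib)
    ultimately have "2 ^ n * norm z ^ n \<le> exp (A + 1) * Gamma (\<alpha> * real n + 1)" by linarith
    thus ?thesis using pos
      by (simp add: ml_coeff_def norm_mult norm_divide norm_power field_simps)
  qed
  moreover have "summable (\<lambda>n. exp (A + 1) * (1/2::real) ^ n)"
    by (intro summable_mult summable_geometric) auto
  ultimately show ?thesis by (rule summable_comparison_test'[rotated, where N = 0])
qed

lemma mittag_leffler_eq: "mittag_leffler \<alpha> z = (\<Sum>n. ml_coeff \<alpha> n * z ^ n)"
  by (simp add: mittag_leffler_def ml_coeff_def)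

definition mittag_leffler_deriv :: "real \<Rightarrow> complex \<Rightarrow> complex" where
  "mittag_leffler_deriv \<alpha> z = (\<Sum>n. diffs (ml_coeff \<alpha>) n * z ^ n)"

lemma has_field_derivative_mittag_leffler:
  assumes "\<alpha> > 0"
  shows "(mittag_leffler \<alpha> has_field_derivative mittag_leffler_deriv \<alpha> z) (at z)"
  unfolding mittag_leffler_eq[abs_def] mittag_leffler_deriv_def
  by (intro termdiffs_strong_converges_everywhere summable_ml_coeff assms)

lemma continuous_on_mittag_leffler_deriv:
  assumes "\<alpha> > 0"
  shows "continuous_on S (mittag_leffler_deriv \<alpha>)"
  unfolding mittag_leffler_deriv_def
  by (intro continuous_at_imp_continuous_on ballI isCont_powser_converges_everywhere
      termdiff_converges_all summable_ml_coeff assms)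

lemma mittag_leffler_0: "mittag_leffler \<alpha> 0 = 1"
  using powser_zero[of "ml_coeff \<alpha>"] by (simp add: mittag_leffler_eq ml_coeff_def)

section \<open>The kernel on the half-line and its singular derivative\<close>

definition ml_ker :: "real \<Rightarrow> real \<Rightarrow> real \<Rightarrow> complex" where
  "ml_ker \<alpha> c u = mittag_leffler \<alpha> (complex_of_real (c * u powr \<alpha>))"

text \<open>Cut off to \<open>(0, L]\<close>: an integrable function on the whole line, whose vanishing on
  negative arguments makes convolution with it a one-sided integral.\<close>

definition ml_ker_deriv :: "real \<Rightarrow> real \<Rightarrow> real \<Rightarrow> real \<Rightarrow> complex" where
  "ml_ker_deriv \<alpha> c L u = indicator {0<..L} u *\<^sub>R
     (complex_of_real (c * (\<alpha> * u powr (\<alpha> - 1))) *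
        mittag_leffler_deriv \<alpha> (complex_of_real (c * u powr \<alpha>)))"

lemma continuous_on_ml_ker:
  assumes "\<alpha> > 0"
  shows "continuous_on {0..} (ml_ker \<alpha> c)"
proof -
  have "continuous_on UNIV (mittag_leffler \<alpha>)"
    by (intro continuous_at_imp_continuous_on ballI
        DERIV_isCont[OF has_field_derivative_mittag_leffler[OF assms]])
  moreover have "continuous_on {0..} (\<lambda>u. complex_of_real (c * u powr \<alpha>))"
    using assms
    by (intro continuous_on_of_real continuous_on_mult_left continuous_on_powr' continuous_intros) auto
  ultimately show ?thesis unfolding ml_ker_def
    by (rule continuous_on_compose2) auto
qed

lemma has_vector_derivative_ml_ker:
  assumes "\<alpha> > 0" "0 < u" "u \<le> L"
  shows "(ml_ker \<alpha> c has_vector_derivative ml_ker_deriv \<alpha> c L u) (at u)"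
proof -
  have "((\<lambda>u. c * u powr \<alpha>) has_real_derivative c * (\<alpha> * u powr (\<alpha> - 1))) (at u)"
    using assms by (auto intro!: derivative_eq_intros)
  hence "((\<lambda>u. complex_of_real (c * u powr \<alpha>)) has_vector_derivative
      complex_of_real (c * (\<alpha> * u powr (\<alpha> - 1)))) (at u)"
    by (intro has_vector_derivative_of_real) (simp add: has_real_derivative_iff_has_vector_derivative)
  from field_vector_diff_chain_within[OF this has_field_derivative_at_within[OF has_field_derivative_mittag_leffler[OF assms(1)]]]
  show ?thesis using assms by (simp add: ml_ker_def[abs_def] ml_ker_deriv_def o_def)
qed

text \<open>On the bounded range of arguments the entire factor \<open>mittag_leffler_deriv\<close>
  is bounded, so the only possible singularity is that of \<open>u powr (\<alpha> - 1)\<close> at 0.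
  It is integrable because the exponent exceeds -1.\<close>

lemma integrable_ml_ker_deriv:
  assumes "\<alpha> > 0"
  shows "integrable lborel (ml_ker_deriv \<alpha> c L)"
proof -
  let ?h = "\<lambda>u. complex_of_real (c * (\<alpha> * u powr (\<alpha> - 1))) *
        mittag_leffler_deriv \<alpha> (complex_of_real (c * u powr \<alpha>))"
  let ?E = "\<lambda>u. mittag_leffler_deriv \<alpha> (complex_of_real (c * u powr \<alpha>))"
  have "continuous_on {0<..L} ?h"
    using assms
    by (intro continuous_intros continuous_on_compose2[OF continuous_on_mittag_leffler_deriv[of \<alpha> UNIV]]) auto
  hence meas: "ml_ker_deriv \<alpha> c L \<in> borel_measurable lborel"
    unfolding ml_ker_deriv_def[abs_def]
    by (auto intro!: borel_measurable_continuous_on_indicator)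
  have "continuous_on {0..L} ?E"
    using assms
    by (intro continuous_on_compose2[OF continuous_on_mittag_leffler_deriv[of \<alpha> UNIV]]
        continuous_on_of_real continuous_on_mult_left continuous_on_powr' continuous_intros) auto
  hence "bounded (?E ` {0..L})"
    by (intro compact_imp_bounded compact_continuous_image) auto
  then obtain M where M: "\<And>u. u \<in> {0..L} \<Longrightarrow> norm (?E u) \<le> M"
    unfolding bounded_iff by blast
  have "set_integrable lborel {0..L} (\<lambda>u. u powr (\<alpha> - 1))"
  proof (cases "L \<ge> 0")
    case True
    have "(\<lambda>u. u powr (\<alpha> - 1)) integrable_on {0..L}"
      using has_integral_powr_from_0[of "\<alpha> - 1" L] assms True by auto
    hence "(\<lambda>u. u powr (\<alpha> - 1)) absolutely_integrable_on {0..L}"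
      by (intro nonnegative_absolutely_integrable_1) auto
    \<comment> \<open>Absolute integrability refers to the completed measure; for a Borel function
      it agrees with integrability over \<open>lborel\<close>.\<close>
    thus ?thesis unfolding set_integrable_def
      by (subst (asm) integrable_completion) auto
  qed (auto simp: set_integrable_def)
  hence "integrable lborel (\<lambda>u. (\<bar>c\<bar> * \<alpha> * M) * (indicator {0..L} u *\<^sub>R (u powr (\<alpha> - 1))))"
    unfolding set_integrable_def by (rule integrable_mult_right)
  thus ?thesis
  proof (rule Bochner_Integration.integrable_bound[OF _ meas], intro AE_I2)
    fix u :: real
    show "norm (ml_ker_deriv \<alpha> c L u) \<le> norm ((\<bar>c\<bar> * \<alpha> * M) * (indicator {0..L} u *\<^sub>R (u powr (\<alpha> - 1))))"
    proof (cases "u \<in> {0<..L}")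
      case True
      have E: "norm (?E u) \<le> M" using M[of u] True by simp
      hence "M \<ge> 0" using norm_ge_zero order_trans by blast
      from E
      have "\<bar>c\<bar> * \<alpha> * u powr (\<alpha> - 1) * norm (?E u) \<le> \<bar>c\<bar> * \<alpha> * u powr (\<alpha> - 1) * M"
        using assms by (intro mult_left_mono) auto
      thus ?thesis using True assms \<open>M \<ge> 0\<close>
        by (simp add: ml_ker_deriv_def norm_mult abs_mult mult_ac)
    qed (simp add: ml_ker_deriv_def)
  qed
qed

text \<open>The derivative may blow up at 0, so the fundamental theorem is used in the form that
  asks for continuity on the closed interval and differentiability only inside. The 1 is the value
  of the kernel at 0.\<close>

lemma integral_ml_ker_deriv:
  assumes "\<alpha> > 0" "0 \<le> u" "u \<le> L"
  shows "(LINT t|lborel. indicator {0..u} t *\<^sub>R ml_ker_deriv \<alpha> c L t) = ml_ker \<alpha> c u - 1"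
proof -
  have "(ml_ker_deriv \<alpha> c L has_integral (ml_ker \<alpha> c u - ml_ker \<alpha> c 0)) {0..u}"
    using assms
    by (intro fundamental_theorem_of_calculus_interior has_vector_derivative_ml_ker
         continuous_on_subset[OF continuous_on_ml_ker]) auto
  moreover have "ml_ker \<alpha> c 0 = 1" by (simp add: ml_ker_def mittag_leffler_0)
  moreover have "set_integrable lborel {0..u} (ml_ker_deriv \<alpha> c L)"
    unfolding set_integrable_def
    by (intro integrable_mult_indicator integrable_ml_ker_deriv assms) auto
  ultimately show ?thesis
    using set_borel_integral_eq_integral(2)[of "{0..u}" "ml_ker_deriv \<alpha> c L"]
    by (simp add: set_lebesgue_integral_def integral_unique)
qed

subsection \<open>Convolution with an integrable kernel\<close>

text \<open>Taken over the whole line: with functions extended by zero and a kernel cut off, the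
  limits of integration are carried by the integrands.\<close>

definition conv :: "(real \<Rightarrow> complex) \<Rightarrow> (real \<Rightarrow> complex) \<Rightarrow> real \<Rightarrow> complex" where
  "conv f k t = (LINT x|lborel. f x * k (t - x))"

lemma integrable_bounded_mult:
  fixes f g :: "real \<Rightarrow> complex"
  assumes "f \<in> borel_measurable lborel" "\<And>x. norm (f x) \<le> M" "integrable lborel g"
  shows "integrable lborel (\<lambda>x. f x * g x)"
proof (rule Bochner_Integration.integrable_bound)
  show "integrable lborel (\<lambda>x. M *\<^sub>R g x)" using assms by simp
  show "AE x in lborel. norm (f x * g x) \<le> norm (M *\<^sub>R g x)"
  proof (intro AE_I2)
    fix x
    show "norm (f x * g x) \<le> norm (M *\<^sub>R g x)"
      using assms(2)[of x] by (simp add: norm_mult mult_right_mono order_trans[OF _ abs_ge_self])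
  qed
qed (use assms in auto)

text \<open>Moves \<open>t\<close> from the kernel to \<open>f\<close>. The kernel is merely
  integrable, so continuity in \<open>t\<close> has to come from \<open>f\<close>.\<close>

lemma conv_eq: "conv f k t = (LINT u|lborel. f (t - u) * k u)"
  unfolding conv_def
  by (subst lborel_integral_real_affine[of "-1" _ t]) auto

text \<open>Dominated convergence with majorant \<open>M * norm (k u)\<close>. The countable
  exceptional set \<open>D\<close> allows for the jumps at the endpoints that extension by zero
  creates.\<close>

lemma continuous_on_conv:
  assumes f: "f \<in> borel_measurable borel" "\<And>x. norm (f x) \<le> M"
    and D: "countable D" "\<And>x. x \<notin> D \<Longrightarrow> isCont f x"
    and k: "integrable lborel k"
  shows "continuous_on S (conv f k)"
proof -
  have "isCont (conv f k) t" for t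
  proof (rule continuous_within_sequentiallyI)
    fix s :: "nat \<Rightarrow> real" assume s: "s \<longlonglongrightarrow> t"
    have [measurable]: "f \<in> borel_measurable borel" "k \<in> borel_measurable borel"
      using f k by auto
    show "(\<lambda>n. conv f k (s n)) \<longlonglongrightarrow> conv f k t"
      unfolding conv_eq
    proof (rule integral_dominated_convergence[where w = "\<lambda>u. M * norm (k u)"])
      show "integrable lborel (\<lambda>u. M * norm (k u))" using k by auto
      \<comment> \<open>The bad values of \<open>u\<close> are those with \<open>t - u\<close> in
        \<open>D\<close>; they form a reflected copy of \<open>D\<close>, still countable and hence
        null.\<close>
      have "countable ((\<lambda>x. t - x) ` D)" using D(1) by simp
      hence "AE u in lborel. u \<notin> (\<lambda>x. t - x) ` D"
        by (intro AE_not_in countable_imp_null_set_lborel)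
      thus "AE u in lborel. (\<lambda>n. f (s n - u) * k u) \<longlonglongrightarrow> f (t - u) * k u"
      proof eventually_elim
        case (elim u)
        have "t - u \<notin> D"
        proof
          assume "t - u \<in> D"
          hence "t - (t - u) \<in> (\<lambda>x. t - x) ` D" by (rule imageI)
          thus False using elim by simp
        qed
        hence "isCont f (t - u)" by (rule D)
        moreover have "(\<lambda>n. s n - u) \<longlonglongrightarrow> t - u" using s by (intro tendsto_intros)
        ultimately have "(\<lambda>n. f (s n - u)) \<longlonglongrightarrow> f (t - u)" by (rule isCont_tendsto_compose)
        thus ?case by (intro tendsto_intros)
      qed
      show "AE u in lborel. norm (f (s n - u) * k u) \<le> M * norm (k u)" for n
        using f(2) by (auto simp: norm_mult intro!: mult_right_mono)
    qed measurable
  qed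
  thus ?thesis by (intro continuous_at_imp_continuous_on) auto
qed

text \<open>Fubini for \<open>f x * g t * k (t - x)\<close>. The inner integral of its norm is at
  most \<open>M\<close> times the L1 norm of \<open>k\<close> times \<open>norm (f x)\<close>, which
  is integrable in \<open>x\<close>. Exchanging the roles of \<open>t\<close> and \<open>x\<close>
  reflects the kernel.\<close>

lemma integral_mult_conv_swap:
  assumes f: "integrable lborel f"
    and g: "g \<in> borel_measurable borel" "\<And>x. norm (g x) \<le> M"
    and k: "integrable lborel k"
  shows "(LINT t|lborel. g t * conv f k t) = (LINT x|lborel. f x * conv g (\<lambda>u. k (- u)) x)"
proof -
  have [measurable]: "f \<in> borel_measurable borel" "g \<in> borel_measurable borel" "k \<in> borel_measurable borel"
    using f g k by auto
  define F where "F = (\<lambda>x t. f x * (g t * k (t - x)))"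
  have kx: "integrable lborel (\<lambda>t. k (t - x))" for x
    using lborel_integrable_real_affine[OF k, of 1 "-x"] by simp
  have Fx: "integrable lborel (F x)" for x
    unfolding F_def using g by (intro integrable_mult_right integrable_bounded_mult[OF _ _ kx]) auto
  have "integrable (lborel \<Otimes>\<^sub>M lborel) (case_prod F)"
  proof (rule lborel_pair.Fubini_integrable)
    show "case_prod F \<in> borel_measurable (lborel \<Otimes>\<^sub>M lborel)"
      unfolding F_def by measurable
    show "AE x in lborel. integrable lborel (\<lambda>t. case_prod F (x, t))" using Fx by simp
    show "integrable lborel (\<lambda>x. LINT t|lborel. norm (case_prod F (x, t)))"
    proof (rule Bochner_Integration.integrable_bound)
      show "integrable lborel (\<lambda>x. (M * (LINT t|lborel. norm (k t))) *\<^sub>R f x)" using f by simp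
      show "(\<lambda>x. LINT t|lborel. norm (case_prod F (x, t))) \<in> borel_measurable lborel"
        unfolding F_def by measurable
      show "AE x in lborel. norm (LINT t|lborel. norm (case_prod F (x, t)))
          \<le> norm ((M * (LINT t|lborel. norm (k t))) *\<^sub>R f x)"
      proof (intro AE_I2)
        fix x
        have "(LINT t|lborel. norm (F x t)) \<le> (LINT t|lborel. (norm (f x) * M) * norm (k (t - x)))"
        proof (rule integral_mono)
          show "integrable lborel (\<lambda>t. norm (F x t))" using Fx by simp
          show "integrable lborel (\<lambda>t. (norm (f x) * M) * norm (k (t - x)))" using kx by simp
          show "norm (F x t) \<le> (norm (f x) * M) * norm (k (t - x))" for t
            using g(2)[of t] by (auto simp: F_def norm_mult mult.assoc intro!: mult_left_mono mult_right_mono)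
        qed
        also have "\<dots> = (norm (f x) * M) * (LINT t|lborel. norm (k t))"
          using lborel_integral_real_affine[of 1 "\<lambda>t. norm (k t)" "-x"] by simp
        finally have "(LINT t|lborel. norm (F x t)) \<le> (M * (LINT t|lborel. norm (k t))) * norm (f x)"
          by (simp add: mult_ac)
        also have "\<dots> \<le> norm ((M * (LINT t|lborel. norm (k t))) *\<^sub>R f x)"
          by (simp add: mult_right_mono del: abs_mult)
        finally show "norm (LINT t|lborel. norm (case_prod F (x, t)))
          \<le> norm ((M * (LINT t|lborel. norm (k t))) *\<^sub>R f x)"
          by (simp add: integral_nonneg_AE)
      qed
    qed
  qed
  from lborel_pair.Fubini_integral[OF this]
  have "(LINT t|lborel. LINT x|lborel. F x t) = (LINT x|lborel. LINT t|lborel. F x t)" .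
  moreover have "(LINT x|lborel. F x t) = g t * conv f k t" for t
    unfolding conv_def F_def by (subst integral_mult_right_zero[symmetric]) (simp add: mult_ac)
  moreover have "(LINT t|lborel. F x t) = f x * conv g (\<lambda>u. k (- u)) x" for x
    unfolding conv_def F_def by simp
  ultimately show ?thesis by simp
qed

section \<open>Continuous functions extended by zero\<close>

lemma isCont_indicator_Icc_scaleR:
  fixes f :: "real \<Rightarrow> complex"
  assumes "continuous_on {a..b} f" "x \<notin> {a, b}"
  shows "isCont (\<lambda>x. indicator {a..b} x *\<^sub>R f x) x"
proof (cases "x \<in> {a<..<b}")
  case True
  have "isCont f x"
    using assms(1) True continuous_on_interior[of "{a..b}" f x] by auto
  moreover have "eventually (\<lambda>y. y \<in> {a<..<b}) (nhds x)"
    using True by (intro eventually_nhds_in_open) auto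
  hence "eventually (\<lambda>y. indicator {a..b} y *\<^sub>R f y = f y) (nhds x)"
    by eventually_elim auto
  ultimately show ?thesis by (simp add: isCont_cong)
next
  case False
  have "eventually (\<lambda>y. y \<in> - {a..b}) (nhds x)"
    using False assms(2) by (intro eventually_nhds_in_open) auto
  hence "eventually (\<lambda>y. indicator {a..b} y *\<^sub>R f y = 0) (nhds x)"
    by eventually_elim (auto simp: indicator_def)
  from isCont_cong[OF this] show ?thesis by simp
qed

text \<open>The bridge between the gauge integrals over \<open>{a..b}\<close> in the definitions and
  Lebesgue integrals over the line, where Fubini and dominated convergence apply.\<close>

lemma continuous_indicator_Icc:
  fixes f :: "real \<Rightarrow> complex"
  assumes "continuous_on {a..b} f"
  shows "(\<lambda>x. indicator {a..b} x *\<^sub>R f x) \<in> borel_measurable borel"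
    and "integrable lborel (\<lambda>x. indicator {a..b} x *\<^sub>R f x)"
    and "(LINT x|lborel. indicator {a..b} x *\<^sub>R f x) = integral {a..b} f"
    and "\<exists>M. \<forall>x. norm (indicator {a..b} x *\<^sub>R f x) \<le> M"
proof -
  show 1: "(\<lambda>x. indicator {a..b} x *\<^sub>R f x) \<in> borel_measurable borel"
    using assms by (intro borel_measurable_continuous_on_indicator) auto
  show 2: "integrable lborel (\<lambda>x. indicator {a..b} x *\<^sub>R f x)"
    using borel_integrable_atLeastAtMost'[OF assms] by (simp add: set_integrable_def)
  show "(LINT x|lborel. indicator {a..b} x *\<^sub>R f x) = integral {a..b} f"
    using set_borel_integral_eq_integral(2)[of "{a..b}" f] 2
    by (simp add: set_lebesgue_integral_def set_integrable_def)
  have "bounded (f ` {a..b})"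
    by (intro compact_imp_bounded compact_continuous_image assms) auto
  then obtain M where "\<And>x. x \<in> {a..b} \<Longrightarrow> norm (f x) \<le> M"
    unfolding bounded_iff by blast
  \<comment> \<open>\<open>max M 0\<close> because the extension is 0 outside the interval, and
    \<open>M\<close> might be negative if the interval is empty.\<close>
  hence "norm (indicator {a..b} x *\<^sub>R f x) \<le> max M 0" for x
    by (cases "x \<in> {a..b}") (auto simp: le_max_iff_disj)
  thus "\<exists>M. \<forall>x. norm (indicator {a..b} x *\<^sub>R f x) \<le> M" by blast
qed

subsection \<open>The fractional derivatives of a continuous function\<close>

lemma integral_conv_Icc:
  fixes f :: "real \<Rightarrow> complex"
  assumes f: "continuous_on {a..b} f" and k: "integrable lborel k"
  shows "continuous_on S (conv (\<lambda>x. indicator {a..b} x *\<^sub>R f x) k)" (is "continuous_on S ?C")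
    and "integral {c..d} (conv (\<lambda>x. indicator {a..b} x *\<^sub>R f x) k) =
      (LINT x|lborel. indicator {a..b} x *\<^sub>R f x * (LINT t|lborel. indicator {c..d} t *\<^sub>R k (t - x)))"
proof -
  obtain M where M: "\<And>x. norm (indicator {a..b} x *\<^sub>R f x) \<le> M"
    using continuous_indicator_Icc(4)[OF f] by blast
  show cont: "continuous_on S ?C" for S
    by (rule continuous_on_conv[OF _ M, where D = "{a, b}"])
      (use f k in \<open>auto intro!: isCont_indicator_Icc_scaleR continuous_indicator_Icc(1)\<close>)
  have "integral {c..d} ?C = (LINT t|lborel. indicator {c..d} t *\<^sub>R 1 * ?C t)"
    by (subst continuous_indicator_Icc(3)[OF cont, symmetric]) simp
  also have "\<dots> = (LINT x|lborel. indicator {a..b} x *\<^sub>R f x *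
      conv (\<lambda>t. indicator {c..d} t *\<^sub>R 1) (\<lambda>u. k (- u)) x)"
    by (intro integral_mult_conv_swap[where M = 1] continuous_indicator_Icc(2) f k)
      (auto simp: indicator_def)
  finally show "integral {c..d} ?C =
      (LINT x|lborel. indicator {a..b} x *\<^sub>R f x * (LINT t|lborel. indicator {c..d} t *\<^sub>R k (t - x)))"
    by (simp add: conv_def)
qed

lemma integrable_lborel_uminus:
  fixes k :: "real \<Rightarrow> complex"
  assumes "integrable lborel k"
  shows "integrable lborel (\<lambda>u. k (- u))"
  using lborel_integrable_real_affine[OF assms, of "-1" 0] by simp

text \<open>Exhibits the integral in the left derivative as a primitive of \<open>f + f * k\<close>
  (\<open>*\<close> being convolution), which avoids differentiating under the integral sign. By
  Fubini the integral of the convolution is that of \<open>f x\<close> against the primitive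
  \<open>K (T - x) - 1\<close> of \<open>k\<close>. The cut-off \<open>b - a\<close> suffices
  because all arguments \<open>T - x\<close> with x \<le> T are at most that.\<close>

lemma integral_ml_ker_left:
  fixes f :: "real \<Rightarrow> complex"
  assumes f: "continuous_on {a..b} f" and "\<alpha> > 0" and T: "T \<in> {a..b}"
  shows "integral {a..T} (\<lambda>x. f x * ml_ker \<alpha> c (T - x)) =
    integral {a..T} (\<lambda>s. f s + conv (\<lambda>x. indicator {a..b} x *\<^sub>R f x) (ml_ker_deriv \<alpha> c (b - a)) s)"
proof -
  define k where "k = ml_ker_deriv \<alpha> c (b - a)"
  define K where "K = ml_ker \<alpha> c"
  have k: "integrable lborel k" unfolding k_def by (intro integrable_ml_ker_deriv assms)
  have fT: "continuous_on {a..T} f" using f T by (auto intro: continuous_on_subset)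
  have KT: "continuous_on {a..T} (\<lambda>x. K (T - x))" unfolding K_def
    by (intro continuous_on_compose2[OF continuous_on_ml_ker] continuous_intros assms) auto
  have inner: "(LINT t|lborel. indicator {a..T} t *\<^sub>R k (t - x)) =
      indicator {a..T} x *\<^sub>R (K (T - x) - 1)" if x: "x \<in> {a..b}" for x
  proof -
    have "(LINT t|lborel. indicator {a..T} t *\<^sub>R k (t - x)) =
        (LINT u|lborel. indicator {a..T} (x + u) *\<^sub>R k u)"
      by (subst lborel_integral_real_affine[of 1 _ x]) auto
    \<comment> \<open>Where u > 0, the condition a \<le> x + u follows from a \<le> x; where u \<le>
      0, \<open>k\<close> vanishes.\<close>
    also have "(\<lambda>u. indicator {a..T} (x + u) *\<^sub>R k u) = (\<lambda>u. indicator {0..T-x} u *\<^sub>R k u)"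
      using x by (auto simp: k_def ml_ker_deriv_def indicator_def)
    also have "(LINT u|lborel. indicator {0..T-x} u *\<^sub>R k u) = indicator {a..T} x *\<^sub>R (K (T - x) - 1)"
      using integral_ml_ker_deriv[of \<alpha> "T - x" "b - a" c] assms x
      by (cases "x \<le> T") (auto simp: k_def K_def)
    finally show ?thesis .
  qed
  have "integral {a..T} (conv (\<lambda>x. indicator {a..b} x *\<^sub>R f x) k) =
      (LINT x|lborel. indicator {a..T} x *\<^sub>R (f x * (K (T - x) - 1)))"
    unfolding integral_conv_Icc(2)[OF f k]
  proof (intro Bochner_Integration.integral_cong refl)
    fix x
    show "indicator {a..b} x *\<^sub>R f x * (LINT t|lborel. indicator {a..T} t *\<^sub>R k (t - x)) =
        indicator {a..T} x *\<^sub>R (f x * (K (T - x) - 1))"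
    proof (cases "x \<in> {a..b}")
      case True
      thus ?thesis unfolding inner[OF True] by simp
    qed (use T in \<open>auto simp: indicator_def\<close>)
  qed
  also have "\<dots> = integral {a..T} (\<lambda>x. f x * (K (T - x) - 1))"
    by (intro continuous_indicator_Icc(3) continuous_intros fT KT)
  finally have "integral {a..T} (\<lambda>s. f s + conv (\<lambda>x. indicator {a..b} x *\<^sub>R f x) k s) =
      integral {a..T} f + integral {a..T} (\<lambda>x. f x * (K (T - x) - 1))"
    using integral_add[OF integrable_continuous_real[OF fT]
        integrable_continuous_real[OF integral_conv_Icc(1)[OF f k, of "{a..T}"]]] by simp
  also have "\<dots> = integral {a..T} (\<lambda>x. f x + f x * (K (T - x) - 1))"
    by (intro integral_add[symmetric] integrable_continuous_real continuous_intros fT KT)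
  finally show ?thesis by (simp add: k_def K_def algebra_simps)
qed

text \<open>The mirror image of \<open>integral_ml_ker_left\<close>: the substitution t = x - u
  brings the reflected kernel back to \<open>k\<close>.\<close>

lemma integral_ml_ker_right:
  fixes f :: "real \<Rightarrow> complex"
  assumes f: "continuous_on {a..b} f" and "\<alpha> > 0" and T: "T \<in> {a..b}"
  shows "integral {T..b} (\<lambda>x. f x * ml_ker \<alpha> c (x - T)) =
    integral {T..b} (\<lambda>s. f s +
      conv (\<lambda>x. indicator {a..b} x *\<^sub>R f x) (\<lambda>u. ml_ker_deriv \<alpha> c (b - a) (- u)) s)"
proof -
  define k where "k = ml_ker_deriv \<alpha> c (b - a)"
  define K where "K = ml_ker \<alpha> c"
  have k: "integrable lborel (\<lambda>u. k (- u))"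
    unfolding k_def by (intro integrable_ml_ker_deriv integrable_lborel_uminus assms)
  have fT: "continuous_on {T..b} f" using f T by (auto intro: continuous_on_subset)
  have KT: "continuous_on {T..b} (\<lambda>x. K (x - T))" unfolding K_def
    by (intro continuous_on_compose2[OF continuous_on_ml_ker] continuous_intros assms) auto
  have inner: "(LINT t|lborel. indicator {T..b} t *\<^sub>R k (- (t - x))) =
      indicator {T..b} x *\<^sub>R (K (x - T) - 1)" if x: "x \<in> {a..b}" for x
  proof -
    have "(LINT t|lborel. indicator {T..b} t *\<^sub>R k (- (t - x))) =
        (LINT u|lborel. indicator {T..b} (x - u) *\<^sub>R k u)"
      by (subst lborel_integral_real_affine[of "-1" _ x]) auto
    also have "(\<lambda>u. indicator {T..b} (x - u) *\<^sub>R k u) = (\<lambda>u. indicator {0..x-T} u *\<^sub>R k u)"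
      using x by (auto simp: k_def ml_ker_deriv_def indicator_def)
    also have "(LINT u|lborel. indicator {0..x-T} u *\<^sub>R k u) = indicator {T..b} x *\<^sub>R (K (x - T) - 1)"
      using integral_ml_ker_deriv[of \<alpha> "x - T" "b - a" c] assms x
      by (cases "T \<le> x") (auto simp: k_def K_def)
    finally show ?thesis .
  qed
  have "integral {T..b} (conv (\<lambda>x. indicator {a..b} x *\<^sub>R f x) (\<lambda>u. k (- u))) =
      (LINT x|lborel. indicator {T..b} x *\<^sub>R (f x * (K (x - T) - 1)))"
    unfolding integral_conv_Icc(2)[OF f k]
  proof (intro Bochner_Integration.integral_cong refl)
    fix x
    show "indicator {a..b} x *\<^sub>R f x * (LINT t|lborel. indicator {T..b} t *\<^sub>R k (- (t - x))) =
        indicator {T..b} x *\<^sub>R (f x * (K (x - T) - 1))"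
    proof (cases "x \<in> {a..b}")
      case True
      thus ?thesis unfolding inner[OF True] by simp
    qed (use T in \<open>auto simp: indicator_def\<close>)
  qed
  also have "\<dots> = integral {T..b} (\<lambda>x. f x * (K (x - T) - 1))"
    by (intro continuous_indicator_Icc(3) continuous_intros fT KT)
  finally have "integral {T..b} (\<lambda>s. f s + conv (\<lambda>x. indicator {a..b} x *\<^sub>R f x) (\<lambda>u. k (- u)) s) =
      integral {T..b} f + integral {T..b} (\<lambda>x. f x * (K (x - T) - 1))"
    using integral_add[OF integrable_continuous_real[OF fT]
        integrable_continuous_real[OF integral_conv_Icc(1)[OF f k, of "{T..b}"]]] by simp
  also have "\<dots> = integral {T..b} (\<lambda>x. f x + f x * (K (x - T) - 1))"
    by (intro integral_add[symmetric] integrable_continuous_real continuous_intros fT KT)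
  finally show ?thesis by (simp add: k_def K_def algebra_simps)
qed

text \<open>By \<open>integral_ml_ker_left\<close> the function being differentiated is a primitive
  of a continuous function, so the fundamental theorem gives the derivative at every point,
  one-sided at the endpoints.\<close>

lemma ABR_left_eq:
  assumes f: "continuous_on {a..b} f" and "\<alpha> > 0" "a < b" and t: "t \<in> {a..b}"
  shows "ABR_left B \<alpha> a b f t = complex_of_real (B \<alpha> / (1 - \<alpha>)) *
    (f t + conv (\<lambda>x. indicator {a..b} x *\<^sub>R f x) (ml_ker_deriv \<alpha> (- \<alpha> / (1 - \<alpha>)) (b - a)) t)"
proof -
  let ?h = "\<lambda>s. f s + conv (\<lambda>x. indicator {a..b} x *\<^sub>R f x) (ml_ker_deriv \<alpha> (- \<alpha> / (1 - \<alpha>)) (b - a)) s"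
  have "continuous_on {a..b} ?h"
    by (intro continuous_intros integral_conv_Icc integrable_ml_ker_deriv assms)
  from integral_has_vector_derivative[OF this t]
  have "((\<lambda>s. integral {a..s} (\<lambda>x. f x * ml_ker \<alpha> (- \<alpha> / (1 - \<alpha>)) (s - x)))
      has_vector_derivative ?h t) (at t within {a..b})"
    by (rule has_vector_derivative_transform[OF t, rotated])
       (rule integral_ml_ker_left[OF f assms(2)])
  \<comment> \<open>A derivative within \<open>{a..b}\<close> is unique because the interval is
    nondegenerate.\<close>
  from vector_derivative_within_cbox[OF \<open>a < b\<close> t[folded box_real(2)] this[folded box_real(2)]]
  show ?thesis unfolding ABR_left_def ml_ker_def box_real by simp
qed

lemma ABR_right_eq:
  assumes f: "continuous_on {a..b} f" and "\<alpha> > 0" "a < b" and t: "t \<in> {a..b}"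
  shows "ABR_right B \<alpha> a b f t = complex_of_real (B \<alpha> / (1 - \<alpha>)) *
    (f t + conv (\<lambda>x. indicator {a..b} x *\<^sub>R f x)
             (\<lambda>u. ml_ker_deriv \<alpha> (- \<alpha> / (1 - \<alpha>)) (b - a) (- u)) t)"
proof -
  let ?h = "\<lambda>s. f s + conv (\<lambda>x. indicator {a..b} x *\<^sub>R f x)
      (\<lambda>u. ml_ker_deriv \<alpha> (- \<alpha> / (1 - \<alpha>)) (b - a) (- u)) s"
  have "continuous_on {a..b} ?h"
    by (intro continuous_intros integral_conv_Icc integrable_ml_ker_deriv integrable_lborel_uminus assms)
  \<comment> \<open>Here the lower limit varies, which gives a minus sign; it cancels the one in
    \<open>ABR_right\<close>.\<close>
  from integral_has_vector_derivative'[OF this t]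
  have "((\<lambda>s. integral {s..b} (\<lambda>x. f x * ml_ker \<alpha> (- \<alpha> / (1 - \<alpha>)) (x - s)))
      has_vector_derivative - ?h t) (at t within {a..b})"
    by (rule has_vector_derivative_transform[OF t, rotated])
       (rule integral_ml_ker_right[OF f assms(2)])
  from vector_derivative_within_cbox[OF \<open>a < b\<close> t[folded box_real(2)] this[folded box_real(2)]]
  show ?thesis unfolding ABR_right_def ml_ker_def box_real by (simp only: mult_minus_left mult_minus_right minus_minus)
qed

lemma continuous_on_ABR:
  assumes "continuous_on {a..b} f" "\<alpha> > 0" "a < b"
  shows "continuous_on {a..b} (ABR_left B \<alpha> a b f)" "continuous_on {a..b} (ABR_right B \<alpha> a b f)"
proof -
  have "continuous_on {a..b} (\<lambda>t. complex_of_real (B \<alpha> / (1 - \<alpha>)) *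
    (f t + conv (\<lambda>x. indicator {a..b} x *\<^sub>R f x) (ml_ker_deriv \<alpha> (- \<alpha> / (1 - \<alpha>)) (b - a)) t))"
    by (intro continuous_intros integral_conv_Icc integrable_ml_ker_deriv assms)
  thus "continuous_on {a..b} (ABR_left B \<alpha> a b f)"
    by (subst continuous_on_cong[OF refl ABR_left_eq[OF assms]])
  have "continuous_on {a..b} (\<lambda>t. complex_of_real (B \<alpha> / (1 - \<alpha>)) *
    (f t + conv (\<lambda>x. indicator {a..b} x *\<^sub>R f x)
             (\<lambda>u. ml_ker_deriv \<alpha> (- \<alpha> / (1 - \<alpha>)) (b - a) (- u)) t))"
    by (intro continuous_intros integral_conv_Icc integrable_ml_ker_deriv integrable_lborel_uminus assms)
  thus "continuous_on {a..b} (ABR_right B \<alpha> a b f)"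
    by (subst continuous_on_cong[OF refl ABR_right_eq[OF assms]])
qed

section \<open>Adjointness and the symmetric form of the equation\<close>

text \<open>Fractional integration by parts without boundary terms. The local parts both give the
  integral of \<open>f t * g t\<close>, and the convolution parts agree by
  \<open>integral_mult_conv_swap\<close>.\<close>

lemma integral_mult_ABR_left:
  fixes f g :: "real \<Rightarrow> complex"
  assumes f: "continuous_on {a..b} f" and g: "continuous_on {a..b} g" and "\<alpha> > 0" "a < b"
  shows "integral {a..b} (\<lambda>t. g t * ABR_left B \<alpha> a b f t) =
    integral {a..b} (\<lambda>t. f t * ABR_right B \<alpha> a b g t)"
proof -
  define w where "w = complex_of_real (B \<alpha> / (1 - \<alpha>))"
  define k where "k = ml_ker_deriv \<alpha> (- \<alpha> / (1 - \<alpha>)) (b - a)"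
  have k: "integrable lborel k" "integrable lborel (\<lambda>u. k (- u))"
    unfolding k_def by (intro integrable_ml_ker_deriv integrable_lborel_uminus assms)+
  let ?f = "\<lambda>x. indicator {a..b} x *\<^sub>R f x" and ?g = "\<lambda>x. indicator {a..b} x *\<^sub>R g x"
  note C = integral_conv_Icc(1)[OF f k(1), of "{a..b}"] integral_conv_Icc(1)[OF g k(2), of "{a..b}"]
  note I = integrable_continuous_real
  obtain M where M: "\<And>x. norm (?g x) \<le> M"
    using continuous_indicator_Icc(4)[OF g] by blast
  have "integral {a..b} (\<lambda>t. g t * conv ?f k t) = (LINT t|lborel. ?g t * conv ?f k t)"
    by (subst continuous_indicator_Icc(3)[symmetric]) (auto intro!: continuous_intros g C)
  also have "\<dots> = (LINT t|lborel. ?f t * conv ?g (\<lambda>u. k (- u)) t)"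
    by (intro integral_mult_conv_swap[OF _ _ M] continuous_indicator_Icc f g k)
  also have "\<dots> = integral {a..b} (\<lambda>t. f t * conv ?g (\<lambda>u. k (- u)) t)"
    by (subst continuous_indicator_Icc(3)[symmetric]) (auto intro!: continuous_intros f C)
  finally have swap: "integral {a..b} (\<lambda>t. g t * conv ?f k t) =
    integral {a..b} (\<lambda>t. f t * conv ?g (\<lambda>u. k (- u)) t)" .
  have "integral {a..b} (\<lambda>t. g t * ABR_left B \<alpha> a b f t) =
      integral {a..b} (\<lambda>t. w * (g t * f t + g t * conv ?f k t))"
    by (intro integral_cong) (simp add: ABR_left_eq[OF f assms(3,4)] w_def k_def algebra_simps)
  also have "\<dots> = w * (integral {a..b} (\<lambda>t. g t * f t) + integral {a..b} (\<lambda>t. g t * conv ?f k t))"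
    by (subst integral_mult_right, subst integral_add) (auto intro!: I continuous_intros f g C)
  also have "\<dots> = w * (integral {a..b} (\<lambda>t. g t * f t) + integral {a..b} (\<lambda>t. f t * conv ?g (\<lambda>u. k (- u)) t))"
    by (simp only: swap)
  also have "\<dots> = integral {a..b} (\<lambda>t. w * (g t * f t + f t * conv ?g (\<lambda>u. k (- u)) t))"
    by (subst integral_mult_right, subst integral_add) (auto intro!: I continuous_intros f g C)
  also have "\<dots> = integral {a..b} (\<lambda>t. f t * ABR_right B \<alpha> a b g t)"
    by (intro integral_cong) (simp add: ABR_right_eq[OF g assms(3,4)] w_def k_def algebra_simps)
  finally show ?thesis .
qed

text \<open>The weak form: multiply the equation by \<open>y\<close>, integrate, and move the left
  derivative onto \<open>y\<close>. The right-hand side is symmetric in \<open>x\<close> and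
  \<open>y\<close>.\<close>

lemma FSL_solution_integral:
  fixes y :: "real \<Rightarrow> complex"
  assumes sol: "FSL_solution B \<alpha> a b p q r \<mu> x" and y: "continuous_on {a..b} y"
    and "a < b" "\<alpha> > 0" "continuous_on {a..b} q" "continuous_on {a..b} r"
  shows "\<mu> * integral {a..b} (\<lambda>t. r t * x t * y t) =
    integral {a..b} (\<lambda>t. p t * ABR_right B \<alpha> a b x t * ABR_right B \<alpha> a b y t) +
    integral {a..b} (\<lambda>t. q t * x t * y t)"
proof -
  let ?u = "\<lambda>s. complex_of_real (p s) * ABR_right B \<alpha> a b x s"
  have x: "continuous_on {a..b} x" and u: "continuous_on {a..b} ?u"
    using sol by (auto simp: FSL_solution_def H1_on_def)
  have eq: "y t * ABR_left B \<alpha> a b ?u t + q t * x t * y t = \<mu> * (r t * x t * y t)"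
    if "t \<in> {a..b} - {a, b}" for t
  proof -
    have "ABR_left B \<alpha> a b ?u t + q t * x t = \<mu> * r t * x t"
      using sol that by (auto simp: FSL_solution_def)
    hence "(ABR_left B \<alpha> a b ?u t + q t * x t) * y t = (\<mu> * r t * x t) * y t" by simp
    thus ?thesis by (simp add: algebra_simps)
  qed
  have "\<mu> * integral {a..b} (\<lambda>t. r t * x t * y t) = integral {a..b} (\<lambda>t. \<mu> * (r t * x t * y t))"
    by (rule integral_mult_right[symmetric])
  \<comment> \<open>The equation is available only inside the interval; the two endpoints are
    negligible.\<close>
  also have "\<dots> = integral {a..b} (\<lambda>t. y t * ABR_left B \<alpha> a b ?u t + q t * x t * y t)"
    by (rule integral_spike[of "{a, b}"]) (use eq in auto)
  also have "\<dots> = integral {a..b} (\<lambda>t. y t * ABR_left B \<alpha> a b ?u t) + integral {a..b} (\<lambda>t. q t * x t * y t)"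
    by (intro integral_add integrable_continuous_real continuous_intros continuous_on_ABR assms x u)
  finally show ?thesis
    by (simp add: integral_mult_ABR_left[OF u y assms(4,3)])
qed

theorem theorem7:
  fixes a b \<alpha> :: real and B p q r :: "real \<Rightarrow> real"
    and \<mu>1 \<mu>2 :: complex and x1 x2 :: "real \<Rightarrow> complex"
  assumes "a < b" and "0 < \<alpha>" and "\<alpha> < 1" and "B \<alpha> > 0"
    and "continuous_on {a..b} p" and "continuous_on {a..b} q" and "continuous_on {a..b} r"
    and "\<And>t. t \<in> {a..b} \<Longrightarrow> p t > 0" and "\<And>t. t \<in> {a..b} \<Longrightarrow> r t > 0"
    and "FSL_eigenvalue B \<alpha> a b p q r \<mu>1" and "FSL_eigenvalue B \<alpha> a b p q r \<mu>2"
    and "\<mu>1 \<noteq> \<mu>2"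
    and "FSL_eigenfunction B \<alpha> a b p q r \<mu>1 x1"
    and "FSL_eigenfunction B \<alpha> a b p q r \<mu>2 x2"
  shows "integral {a..b} (\<lambda>t. complex_of_real (r t) * x1 t * x2 t) = 0"
proof -
  have sol: "FSL_solution B \<alpha> a b p q r \<mu>1 x1" "FSL_solution B \<alpha> a b p q r \<mu>2 x2"
    using assms by (auto simp: FSL_eigenfunction_def)
  hence x: "continuous_on {a..b} x1" "continuous_on {a..b} x2"
    by (auto simp: FSL_solution_def H1_on_def)
  \<comment> \<open>Testing the equation of \<open>x1\<close> with \<open>x2\<close> and that of
    \<open>x2\<close> with \<open>x1\<close> gives the same right-hand side. No conjugation occurs,
    so complex eigenvalues need no separate treatment.\<close>
  have "\<mu>1 * integral {a..b} (\<lambda>t. r t * x1 t * x2 t) = \<mu>2 * integral {a..b} (\<lambda>t. r t * x1 t * x2 t)"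
    using FSL_solution_integral[OF sol(1) x(2)] FSL_solution_integral[OF sol(2) x(1)] assms
    by (simp add: mult_ac)
  thus ?thesis using assms by simp
qed

end
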